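(* Let $G$ be a finite graph, $n$ a positive integer, and $\alpha_1,\beta_1$ complex numbers. Then the following formulas hold (whenever the denominators appearing in them are nonzero), all sums being over all spanning subgraphs $A$ of $G$: (1) with $p=-\alpha_1+\beta_1$, $q=\alpha_1$, $$n^{k(G)}\beta_1^{c(G)}(\alpha_1-\beta_1)^{r(G)}\,T_G\Big(\tfrac{\alpha_1+(n-1)\beta_1}{\alpha_1-\beta_1},\tfrac{\alpha_1}{\beta_1}\Big)=q^{e(G)}\sum_{A\subseteq G}\Big(\frac pq\Big)^{e(A)}\chi_A(n);$$ (2) $$C_G(n)=(n-1)^{e(G)}\sum_{A\subseteq G}\frac{n^{e(A)-v(G)}}{(1-n)^{e(A)}}\,\chi_A(n);$$ (3) with $p_1=\frac{\beta_1-\alpha_1}{n}$, $q_1=\frac{\alpha_1-(1-n)\beta_1}{n}$, $$n^{k(G)-v(G)}\beta_1^{c(G)}(\alpha_1-\beta_1)^{r(G)}\,T_G\Big(\tfrac{\alpha_1+(n-1)\beta_1}{\alpha_1-\beta_1},\tfrac{\alpha_1}{\beta_1}\Big)=q_1^{e(G)}\sum_{A\subseteq G}\Big(\frac{p_1}{q_1}\Big)^{e(A)}(-1)^{e(A)}C_A(n);$$ (4) with $p_2=\frac{n}{\beta_1-\alpha_1}$, $q_2=\frac{\alpha_1-(1-n)\beta_1}{\alpha_1-\beta_1}$, $$(-1)^{e(G)}C_G(n)=q_2^{e(G)}\sum_{A\subseteq G}\Big(\frac{p_2}{q_2}\Big)^{e(A)}n^{k(A)-v(G)}\beta_1^{c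(A)}(\alpha_1-\beta_1)^{r(A)}\,T_A\Big(\tfrac{\alpha_1+(n-1)\beta_1}{\alpha_1-\beta_1},\tfrac{\alpha_1}{\beta_1}\Big).$$
   Context: Graphs are finite and undirected; loops and multiple edges are allowed. $v(G),e(G),k(G)$ are the numbers of vertices, edges and connected components; $r(G)=v(G)-k(G)$ and $c(G)=e(G)-r(G)$. A spanning subgraph $A$ of $G$ has the same vertex set as $G$ and an arbitrary subset of the edges of $G$. $T_G(x,y)$ is the Tutte polynomial: $T_G=T_{G\setminus e}+T_{G/e}$ if $e$ is neither a bridge nor a loop ($G\setminus e$ deletion, $G/e$ contraction), and $T_G(x,y)=x^iy^j$ if all edges of $G$ are bridges or loops, $i$ bridges and $j$ loops. $\chi_G(n)$ is the chromatic polynomial: the number of colorings of the vertices in $n$ colors such that the ends of each edge have different colors. $C_G(n)$ is the flow polynomial: the number of nowhere-zero $n$-flows, i.e. (for a fixed arbitrary orientation of the edges) functions $f\colon E(G)\to\mathbb Z_n\setminus\{0\}$ such that at each vertex the sum of $f$ over incoming edges equals the sum of $f$ over outgoing edges. *)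

theory Defs
  imports Complex_Main "HOL-Library.FuncSet" "HOL-Number_Theory.Cong"
    "HOL-Computational_Algebra.Polynomial"
begin

text \<open>Finite undirected multigraphs: an edge is an abstract name, and \<open>ends\<close> sends it to the
  set of its end vertices, a singleton exactly for a loop.\<close>

record ('v, 'e) multigraph =
  verts :: "'v set"
  edges :: "'e set"
  ends :: "'e \<Rightarrow> 'v set"

definition finite_multigraph :: "('v, 'e) multigraph \<Rightarrow> bool" where
  "finite_multigraph G \<longleftrightarrow> finite (verts G) \<and> finite (edges G) \<and>
     (\<forall>e\<in>edges G. ends G e \<subseteq> verts G \<and> (card (ends G e) = 1 \<or> card (ends G e) = 2))"

definition v_num :: "('v, 'e) multigraph \<Rightarrow> nat" where
  "v_num G = card (verts G)"

definition e_num :: "('v, 'e) multigraph \<Rightarrow> nat" where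
  "e_num G = card (edges G)"

definition adjacency :: "('v, 'e) multigraph \<Rightarrow> ('v \<times> 'v) set" where
  "adjacency G = {(u, w). \<exists>e\<in>edges G. ends G e = {u, w}}"

definition k_num :: "('v, 'e) multigraph \<Rightarrow> nat" where
  "k_num G = card (verts G // (adjacency G)\<^sup>*)"

text \<open>Integer-valued, so that the subtractions are not truncated.\<close>

definition r_num :: "('v, 'e) multigraph \<Rightarrow> int" where
  "r_num G = int (v_num G) - int (k_num G)"

definition c_num :: "('v, 'e) multigraph \<Rightarrow> int" where
  "c_num G = int (e_num G) - r_num G"

definition spanning_subgraphs :: "('v, 'e) multigraph \<Rightarrow> ('v, 'e) multigraph set" where
  "spanning_subgraphs G = (\<lambda>F. G\<lparr>edges := F\<rparr>) ` Pow (edges G)"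

subsection \<open>The Tutte polynomial\<close>

definition is_loop :: "('v, 'e) multigraph \<Rightarrow> 'e \<Rightarrow> bool" where
  "is_loop G e \<longleftrightarrow> e \<in> edges G \<and> card (ends G e) = 1"

definition delete_edge :: "('v, 'e) multigraph \<Rightarrow> 'e \<Rightarrow> ('v, 'e) multigraph" where
  "delete_edge G e = G\<lparr>edges := edges G - {e}\<rparr>"

definition is_bridge :: "('v, 'e) multigraph \<Rightarrow> 'e \<Rightarrow> bool" where
  "is_bridge G e \<longleftrightarrow> e \<in> edges G \<and> k_num (delete_edge G e) > k_num G"

text \<open>The ends of \<open>e\<close> are merged into one of them, so that the vertex type does not change.
  Edges parallel to \<open>e\<close> become loops.\<close>

definition contract_edge :: "('v, 'e) multigraph \<Rightarrow> 'e \<Rightarrow> ('v, 'e) multigraph" where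
  "contract_edge G e =
     (let u = (SOME u. u \<in> ends G e)
      in \<lparr>verts = verts G - (ends G e - {u}),
          edges = edges G - {e},
          ends = (\<lambda>f. (\<lambda>x. if x \<in> ends G e then u else x) ` ends G f)\<rparr>)"

text \<open>Polynomials in \<open>x\<close> and \<open>y\<close> are polynomials in the outer variable \<open>y\<close> whose coefficients are
  polynomials in the inner variable \<open>x\<close>.\<close>

definition var_x :: "complex poly poly" where
  "var_x = [:[:0, 1:]:]"

definition var_y :: "complex poly poly" where
  "var_y = [:0, 1:]"

text \<open>The relation allows any choice of edge at each step; that the result is independent of these
  choices is the well-definedness of the Tutte polynomial.\<close>

inductive tutte_rel :: "('v, 'e) multigraph \<Rightarrow> complex poly poly \<Rightarrow> bool" where
  bridges_loops:
    "(\<And>e. e \<in> edges G \<Longrightarrow> is_bridge G e \<or> is_loop G e) \<Longrightarrow>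
     tutte_rel G (var_x ^ card {e \<in> edges G. is_bridge G e} * var_y ^ card {e \<in> edges G. is_loop G e})"
| deletion_contraction:
    "e \<in> edges G \<Longrightarrow> \<not> is_bridge G e \<Longrightarrow> \<not> is_loop G e \<Longrightarrow>
     tutte_rel (delete_edge G e) P \<Longrightarrow> tutte_rel (contract_edge G e) Q \<Longrightarrow>
     tutte_rel G (P + Q)"

definition tutte_poly :: "('v, 'e) multigraph \<Rightarrow> complex poly poly" where
  "tutte_poly G = (THE P. tutte_rel G P)"

definition tutte :: "('v, 'e) multigraph \<Rightarrow> complex \<Rightarrow> complex \<Rightarrow> complex" where
  "tutte G x y = poly (poly (tutte_poly G) [:y:]) x"

subsection \<open>The chromatic polynomial\<close>

text \<open>A loop admits no proper coloring: its two ends coincide.\<close>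

definition proper_colorings :: "('v, 'e) multigraph \<Rightarrow> nat \<Rightarrow> ('v \<Rightarrow> nat) set" where
  "proper_colorings G n =
     {c \<in> verts G \<rightarrow>\<^sub>E {..<n}. \<forall>e\<in>edges G. \<forall>u w. ends G e = {u, w} \<longrightarrow> c u \<noteq> c w}"

definition chromatic :: "('v, 'e) multigraph \<Rightarrow> nat \<Rightarrow> nat" where
  "chromatic G n = card (proper_colorings G n)"

subsection \<open>The flow polynomial\<close>

text \<open>An orientation maps each edge to the pair (tail, head).\<close>

definition orientation :: "('v, 'e) multigraph \<Rightarrow> ('e \<Rightarrow> 'v \<times> 'v) \<Rightarrow> bool" where
  "orientation G d \<longleftrightarrow> (\<forall>e\<in>edges G. ends G e = {fst (d e), snd (d e)})"

text \<open>Nonzero elements of \<open>\<int>/n\<int>\<close> are represented by the residues \<open>1, \<dots>, n - 1\<close>.\<close>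

definition nowhere_zero_flows ::
  "('v, 'e) multigraph \<Rightarrow> ('e \<Rightarrow> 'v \<times> 'v) \<Rightarrow> nat \<Rightarrow> ('e \<Rightarrow> nat) set" where
  "nowhere_zero_flows G d n =
     {f \<in> edges G \<rightarrow>\<^sub>E {1..<n}. \<forall>v\<in>verts G.
        [(\<Sum>e\<in>{e \<in> edges G. snd (d e) = v}. f e) = (\<Sum>e\<in>{e \<in> edges G. fst (d e) = v}. f e)] (mod n)}"

definition flow :: "('v, 'e) multigraph \<Rightarrow> nat \<Rightarrow> nat" where
  "flow G n = card (nowhere_zero_flows G (SOME d. orientation G d) n)"

lemma nowhere_zero_flows_alt:
  assumes "finite (edges G)"
  shows "f \<in> nowhere_zero_flows G d n \<longleftrightarrow> f \<in> edges G \<rightarrow>\<^sub>E {1..<n} \<and>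
    (\<forall>v\<in>verts G. int n dvd (\<Sum>e\<in>edges G. int (f e) * (of_bool (snd (d e) = v) - of_bool (fst (d e) = v))))"
proof -
  have *: "(\<Sum>e\<in>edges G. int (f e) * (of_bool (snd (d e) = v) - of_bool (fst (d e) = v)))
      = int (\<Sum>e\<in>{e \<in> edges G. snd (d e) = v}. f e) - int (\<Sum>e\<in>{e \<in> edges G. fst (d e) = v}. f e)" for v
  proof -
    have "int (\<Sum>e\<in>{e \<in> edges G. P e}. f e) = (\<Sum>e\<in>edges G. int (f e) * of_bool (P e))" for P
      unfolding of_nat_sum using assms by (intro sum.mono_neutral_cong_left) auto
    then show ?thesis
      by (simp only: right_diff_distrib sum_subtractf)
  qed
  show ?thesis
    unfolding nowhere_zero_flows_def * cong_int_iff[symmetric] cong_iff_dvd_diff by blast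
qed

lemma reverse_flow:
  assumes "finite (edges G)" "orientation G d" "orientation G d'" "f \<in> nowhere_zero_flows G d n"
  shows "restrict (\<lambda>e. if d e = d' e then f e else n - f e) (edges G) \<in> nowhere_zero_flows G d' n"
    (is "?g \<in> _")
proof -
  have f: "f \<in> edges G \<rightarrow>\<^sub>E {1..<n}"
    and div: "\<And>v. v \<in> verts G \<Longrightarrow>
      int n dvd (\<Sum>e\<in>edges G. int (f e) * (of_bool (snd (d e) = v) - of_bool (fst (d e) = v)))"
    using assms(4) unfolding nowhere_zero_flows_alt[OF assms(1)] by auto
  have r: "f e \<ge> 1 \<and> f e < n" if "e \<in> edges G" for e
    using f that by (auto simp: PiE_iff)
  have g: "?g \<in> edges G \<rightarrow>\<^sub>E {1..<n}"
    using r by (fastforce simp: PiE_iff)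
  have step: "int n dvd int (?g e) * (of_bool (snd (d' e) = v) - of_bool (fst (d' e) = v))
      - int (f e) * (of_bool (snd (d e) = v) - of_bool (fst (d e) = v))" if e: "e \<in> edges G" for e v
  proof (cases "d e = d' e")
    case True
    then show ?thesis using e by simp
  next
    case False
    have "{fst (d e), snd (d e)} = {fst (d' e), snd (d' e)}"
      using assms(2,3) e unfolding orientation_def by metis
    then have sw: "fst (d' e) = snd (d e)" "snd (d' e) = fst (d e)"
      using False by (auto simp: doubleton_eq_iff prod_eq_iff)
    have *: "int (?g e) = int n - int (f e)"
      using False e r[OF e] by simp
    have "(int n - k) * (a - b) - k * (b - a) = int n * (a - b)" for k a b :: int
      by (simp add: algebra_simps)
    then show ?thesis
      unfolding sw * by (metis dvd_triv_left)
  qed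
  have "int n dvd (\<Sum>e\<in>edges G. int (?g e) * (of_bool (snd (d' e) = v) - of_bool (fst (d' e) = v)))"
    if "v \<in> verts G" for v
  proof -
    have "int n dvd (\<Sum>e\<in>edges G. int (?g e) * (of_bool (snd (d' e) = v) - of_bool (fst (d' e) = v))
      - int (f e) * (of_bool (snd (d e) = v) - of_bool (fst (d e) = v)))"
      by (intro dvd_sum step)
    from dvd_add[OF this div[OF that]] show ?thesis
      by (simp only: sum_subtractf diff_add_cancel)
  qed
  then show ?thesis
    using g unfolding nowhere_zero_flows_alt[OF assms(1)] by blast
qed

lemma card_nowhere_zero_flows_orientation:
  assumes "finite (edges G)" "orientation G d" "orientation G d'"
  shows "card (nowhere_zero_flows G d n) = card (nowhere_zero_flows G d' n)"
proof -
  define h where "h = (\<lambda>f. restrict (\<lambda>e. if d e = d' e then f e else n - f e) (edges G))"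
  have h: "h f \<in> nowhere_zero_flows G d' n" if "f \<in> nowhere_zero_flows G d n" for f
    unfolding h_def using reverse_flow[OF assms that] .
  have h': "h f \<in> nowhere_zero_flows G d n" if "f \<in> nowhere_zero_flows G d' n" for f
    using reverse_flow[OF assms(1,3,2) that] unfolding h_def by (simp add: eq_commute)
  have inv: "h (h f) = f" if "f \<in> edges G \<rightarrow>\<^sub>E {1..<n}" for f
    using that unfolding h_def by (force simp: PiE_iff extensional_def fun_eq_iff)
  have "bij_betw h (nowhere_zero_flows G d n) (nowhere_zero_flows G d' n)"
    by (rule bij_betw_byWitness[where f' = h])
      (use h h' inv in \<open>auto simp: nowhere_zero_flows_alt[OF assms(1)]\<close>)
  then show ?thesis by (rule bij_betw_same_card)
qed

lemma orientation_exists: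
  assumes "finite_multigraph G"
  shows "\<exists>d. orientation G d"
proof -
  have "\<exists>p. ends G e = {fst p, snd p}" if "e \<in> edges G" for e
  proof -
    have "card (ends G e) = 1 \<or> card (ends G e) = 2"
      using assms that unfolding finite_multigraph_def by blast
    then obtain u w where "ends G e = {u, w}"
      by (metis card_1_singletonE card_2_iff insert_absorb2)
    then show ?thesis by (metis fst_conv snd_conv)
  qed
  then show ?thesis unfolding orientation_def by metis
qed

text \<open>Every orientation gives the same count.\<close>

lemma flow_eq:
  assumes "finite_multigraph G" "orientation G d"
  shows "flow G n = card (nowhere_zero_flows G d n)"
  unfolding flow_def
  using assms someI_ex[OF orientation_exists[OF assms(1)]]
  by (intro card_nowhere_zero_flows_orientation) (auto simp: finite_multigraph_def)

end

theory Submission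
  imports Defs
begin

text \<open>All four formulas are instances of one identity for the Potts sum: weight a coloring of the
  vertices by \<open>a\<close> for every monochromatic edge and by \<open>b\<close> for every other edge, and sum over all
  colorings. Expanding the product over the edges of \<open>s w + t\<close>, where \<open>w\<close> is \<open>a\<close> or \<open>b\<close>, turns a sum
  over spanning subgraphs of Potts sums with weights \<open>(a, b)\<close> into the Potts sum of the graph with
  weights \<open>(s a + t, s b + t)\<close>. The chromatic polynomial is the Potts sum with weights \<open>(0, 1)\<close>; the
  flow polynomial, by Fourier inversion of the conservation law on \<open>\<int>/n\<close>, is \<open>n\<close> to the power \<open>- v(G)\<close>
  times the one with weights \<open>(n - 1, - 1)\<close>; and the scaled Tutte polynomial is the one with weights
  \<open>(\<alpha>, \<beta>)\<close>, because both satisfy the same deletion-contraction recursion.\<close>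

section \<open>Potts sums\<close>

text \<open>Phrased on the set of ends, so that the two ends need no order and a loop is
  monochromatic under every coloring.\<close>

definition monochromatic :: "('v \<Rightarrow> 'c) \<Rightarrow> 'v set \<Rightarrow> bool" where
  "monochromatic c S \<longleftrightarrow> (\<forall>x\<in>S. \<forall>y\<in>S. c x = c y)"

text \<open>The partition function of the \<open>n\<close>-state Potts model. A loop always
  contributes \<open>a\<close>.\<close>

definition potts :: "('v, 'e) multigraph \<Rightarrow> nat \<Rightarrow> complex \<Rightarrow> complex \<Rightarrow> complex" where
  "potts G n a b =
     (\<Sum>c\<in>verts G \<rightarrow>\<^sub>E {..<n}. \<Prod>e\<in>edges G. if monochromatic c (ends G e) then a else b)"

text \<open>Serves the fourth formula, where the weights that arise are those of the flow polynomial
  with opposite sign.\<close>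

lemma potts_scale: "potts G n (s * a) (s * b) = s ^ e_num G * potts G n a b"
proof -
  have "(if P then s * a else s * b) = s * (if P then a else b)" for P
    by simp
  then show ?thesis
    by (simp add: potts_def e_num_def prod.distrib sum_distrib_left del: if_distrib)
qed

lemma monochromatic_cong:
  "(\<And>x. x \<in> S \<Longrightarrow> c x = c' x) \<Longrightarrow> monochromatic c S \<longleftrightarrow> monochromatic c' S"
  by (simp add: monochromatic_def)

lemma monochromatic_doubleton: "monochromatic c {u, w} \<longleftrightarrow> c u = c w"
  by (auto simp: monochromatic_def)

lemma monochromatic_comp: "monochromatic (\<lambda>x. c (h x)) S \<longleftrightarrow> monochromatic c (h ` S)"
  by (auto simp: monochromatic_def)

lemma verts_delete_edge [simp]: "verts (delete_edge G e) = verts G"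
  by (simp add: delete_edge_def)

lemma edges_delete_edge [simp]: "edges (delete_edge G e) = edges G - {e}"
  by (simp add: delete_edge_def)

lemma ends_delete_edge [simp]: "ends (delete_edge G e) = ends G"
  by (simp add: delete_edge_def)

lemma finite_multigraph_edges_upd:
  "finite_multigraph G \<Longrightarrow> F \<subseteq> edges G \<Longrightarrow> finite_multigraph (G\<lparr>edges := F\<rparr>)"
  by (auto simp: finite_multigraph_def intro: finite_subset)

lemma finite_multigraph_delete_edge:
  "finite_multigraph G \<Longrightarrow> finite_multigraph (delete_edge G e)"
  by (auto simp: delete_edge_def intro: finite_multigraph_edges_upd)

lemma finite_verts: "finite_multigraph G \<Longrightarrow> finite (verts G)"
  by (simp add: finite_multigraph_def)

lemma finite_edges: "finite_multigraph G \<Longrightarrow> finite (edges G)"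
  by (simp add: finite_multigraph_def)

lemma ends_subset_verts: "finite_multigraph G \<Longrightarrow> e \<in> edges G \<Longrightarrow> ends G e \<subseteq> verts G"
  by (simp add: finite_multigraph_def)

lemma endsE:
  assumes "finite_multigraph G" "e \<in> edges G"
  obtains u w where "ends G e = {u, w}" "u \<in> verts G" "w \<in> verts G"
proof -
  have "card (ends G e) = 1 \<or> card (ends G e) = 2" "ends G e \<subseteq> verts G"
    using assms unfolding finite_multigraph_def by blast+
  then obtain u w where "ends G e = {u, w}"
    by (metis card_1_singletonE card_2_iff insert_absorb2)
  with \<open>ends G e \<subseteq> verts G\<close> that show thesis by blast
qed

lemma finite_colorings: "finite_multigraph G \<Longrightarrow> finite (verts G \<rightarrow>\<^sub>E {..<n::nat})"
  by (intro finite_PiE) (auto dest: finite_verts)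

section \<open>The chromatic polynomial as a Potts sum, and sums over spanning subgraphs\<close>

lemma proper_colorings_eq:
  assumes "finite_multigraph G"
  shows "proper_colorings G n =
    {c \<in> verts G \<rightarrow>\<^sub>E {..<n}. \<forall>e\<in>edges G. \<not> monochromatic c (ends G e)}"
proof -
  have "(\<forall>u w. ends G e = {u, w} \<longrightarrow> c u \<noteq> c w) \<longleftrightarrow> \<not> monochromatic c (ends G e)"
    if "e \<in> edges G" for e and c :: "'a \<Rightarrow> nat"
    using endsE[OF assms that] by (metis monochromatic_doubleton)
  then show ?thesis by (auto simp: proper_colorings_def)
qed

text \<open>Brings a count under simultaneous local conditions into the sum-of-products shape of
  \<open>potts\<close>. The conditions are edge conditions for colorings and vertex conditions for
  flows.\<close>

lemma of_nat_card_eq_sum_prod: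
  assumes "finite X" "finite E"
  shows "(of_nat (card {c \<in> X. \<forall>e\<in>E. P c e}) :: complex) =
    (\<Sum>c\<in>X. \<Prod>e\<in>E. of_bool (P c e))"
proof -
  have "(\<Prod>e\<in>E. of_bool (P c e)) = (of_bool (\<forall>e\<in>E. P c e) :: complex)" for c
    using assms(2) by (auto simp: prod_zero_iff)
  then show ?thesis
    using assms(1) by (simp add: Collect_conj_eq)
qed

lemma chromatic_potts:
  assumes "finite_multigraph G"
  shows "of_nat (chromatic G n) = potts G n 0 1"
  unfolding chromatic_def proper_colorings_eq[OF assms] potts_def
  using finite_colorings[OF assms] finite_edges[OF assms]
  by (subst of_nat_card_eq_sum_prod) (auto intro!: sum.cong prod.cong)

text \<open>Multiplying out, every edge chooses \<open>s\<close> times its weight or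
  \<open>t\<close>; the edges of the first kind form \<open>A\<close>. Stated without division, so
  it also holds for \<open>t = 0\<close>.\<close>

lemma spanning_convolution:
  assumes fin: "finite_multigraph G"
  shows "(\<Sum>A\<in>spanning_subgraphs G. s ^ e_num A * t ^ (e_num G - e_num A) * potts A n a b)
    = potts G n (s * a + t) (s * b + t)"
proof -
  let ?w = "\<lambda>c e. if monochromatic c (ends G e) then a else b"
  have inj: "inj_on (\<lambda>F. G\<lparr>edges := F\<rparr>) (Pow (edges G))"
    by (rule inj_on_inverseI[where g = edges]) simp
  have "potts G n (s * a + t) (s * b + t)
      = (\<Sum>c\<in>verts G \<rightarrow>\<^sub>E {..<n}. \<Prod>e\<in>edges G. s * ?w c e + t)"
    unfolding potts_def by (intro sum.cong prod.cong) auto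
  also have "\<dots> = (\<Sum>c\<in>verts G \<rightarrow>\<^sub>E {..<n}. \<Sum>F\<in>Pow (edges G).
      s ^ card F * t ^ (card (edges G) - card F) * (\<Prod>e\<in>F. ?w c e))"
  proof (intro sum.cong refl)
    fix c :: "'a \<Rightarrow> nat"
    show "(\<Prod>e\<in>edges G. s * ?w c e + t) = (\<Sum>F\<in>Pow (edges G).
      s ^ card F * t ^ (card (edges G) - card F) * (\<Prod>e\<in>F. ?w c e))"
      unfolding prod_add[OF finite_edges[OF fin]]
      using finite_edges[OF fin]
      by (intro sum.cong refl) (auto simp: prod.distrib card_Diff_subset finite_subset mult_ac)
  qed
  also have "\<dots> = (\<Sum>F\<in>Pow (edges G). s ^ card F * t ^ (card (edges G) - card F)
      * (\<Sum>c\<in>verts G \<rightarrow>\<^sub>E {..<n}. \<Prod>e\<in>F. ?w c e))"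
    by (subst sum.swap) (simp add: sum_distrib_left)
  also have "\<dots> = (\<Sum>A\<in>spanning_subgraphs G. s ^ e_num A * t ^ (e_num G - e_num A) * potts A n a b)"
    unfolding spanning_subgraphs_def sum.reindex[OF inj] by (simp add: e_num_def potts_def)
  finally show ?thesis by simp
qed

section \<open>Components and bridges\<close>

lemma adjacency_rtrancl_monochromatic:
  assumes "(x, y) \<in> (adjacency G)\<^sup>*" "\<forall>e\<in>edges G. monochromatic c (ends G e)"
  shows "c x = c y"
  using assms(1)
proof (induction rule: rtrancl_induct)
  case (step y z)
  then show ?case
    using assms(2) by (force simp: adjacency_def monochromatic_def)
qed simp

text \<open>A coloring constant on every edge is constant on components, hence amounts to a function
  on the set of components. This makes \<open>k_num\<close> accessible through counting.\<close>

lemma card_monochromatic_colorings: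
  assumes fin: "finite_multigraph G"
  shows "card {c \<in> verts G \<rightarrow>\<^sub>E {..<n}. \<forall>e\<in>edges G. monochromatic c (ends G e)} = n ^ k_num G"
    (is "card ?M = _")
proof -
  let ?V = "verts G"
  define R where "R = (adjacency G)\<^sup>*"
  have "sym (adjacency G)"
    by (auto simp: sym_def adjacency_def insert_commute)
  then have "equiv UNIV R"
    unfolding R_def by (intro equivI) (auto simp: refl_rtrancl sym_rtrancl trans_rtrancl)
  then have cls: "R `` {x} = R `` {y} \<longleftrightarrow> (x, y) \<in> R" for x y
    by (metis UNIV_I eq_equiv_class_iff)
  have quot: "?V // R = (\<lambda>x. R `` {x}) ` ?V"
    by (auto simp: quotient_def)
  have finQ: "finite (?V // R)"
    unfolding quot using finite_verts[OF fin] by blast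
  define h where "h g = restrict (\<lambda>x. g (R `` {x})) ?V" for g :: "'a set \<Rightarrow> nat"
  have "bij_betw h ((?V // R) \<rightarrow>\<^sub>E {..<n}) ?M"
  proof (rule bij_betw_imageI)
    show "inj_on h ((?V // R) \<rightarrow>\<^sub>E {..<n})"
    proof (rule inj_onI, rule PiE_ext)
      fix g g' C
      assume h: "h g = h g'" and "C \<in> ?V // R"
      then obtain x where "x \<in> ?V" "C = R `` {x}" by (auto simp: quot)
      then show "g C = g' C" using fun_cong[OF h, of x] by (simp add: h_def)
    qed
    show "h ` ((?V // R) \<rightarrow>\<^sub>E {..<n}) = ?M"
    proof (intro equalityI subsetI)
      fix c assume "c \<in> h ` ((?V // R) \<rightarrow>\<^sub>E {..<n})"
      then obtain g where g: "g \<in> (?V // R) \<rightarrow>\<^sub>E {..<n}" "c = h g" by blast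
      have "monochromatic c (ends G e)" if "e \<in> edges G" for e
      proof -
        obtain u w where uw: "ends G e = {u, w}" "u \<in> ?V" "w \<in> ?V"
          using endsE[OF fin \<open>e \<in> edges G\<close>] .
        then have "(u, w) \<in> R" using that by (auto simp: R_def adjacency_def)
        then have "R `` {u} = R `` {w}" by (simp only: cls)
        then show ?thesis
          using uw by (simp add: monochromatic_doubleton g h_def)
      qed
      then show "c \<in> ?M" using g by (auto simp: h_def quot)
    next
      fix c assume c: "c \<in> ?M"
      \<comment> \<open>The color of a class is read off at a representative inside
        \<open>verts G\<close>; \<open>gc\<close> shows that the choice does not matter.\<close>
      define g where "g = restrict (\<lambda>C. c (SOME x. x \<in> ?V \<and> C = R `` {x})) (?V // R)"
      have gc: "g (R `` {x}) = c x" if "x \<in> ?V" for x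
      proof -
        define y where "y = (SOME y. y \<in> ?V \<and> R `` {x} = R `` {y})"
        have "y \<in> ?V \<and> R `` {x} = R `` {y}"
          unfolding y_def by (rule someI) (use that in auto)
        then have "(x, y) \<in> R" using cls[of x y] by simp
        then have "c x = c y"
          unfolding R_def by (rule adjacency_rtrancl_monochromatic) (use c in blast)
        then show ?thesis using that by (simp add: g_def quot y_def)
      qed
      have "h g = restrict c ?V" using gc by (auto simp: h_def)
      also have "restrict c ?V = c"
        using c PiE_restrict[of c ?V "\<lambda>_. {..<n}"] by blast
      finally have "h g = c" .
      moreover have "g \<in> (?V // R) \<rightarrow>\<^sub>E {..<n}"
      proof (rule PiE_I)
        fix C assume "C \<in> ?V // R"
        then obtain x where "x \<in> ?V" "C = R `` {x}" by (auto simp: quot)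
        then show "g C \<in> {..<n}" using gc c by auto
      qed (simp add: g_def)
      ultimately show "c \<in> h ` ((?V // R) \<rightarrow>\<^sub>E {..<n})" by blast
    qed
  qed
  then have "card ?M = card ((?V // R) \<rightarrow>\<^sub>E {..<n})" by (rule bij_betw_same_card[symmetric])
  also have "card ((?V // R) \<rightarrow>\<^sub>E {..<n}) = n ^ k_num G"
    using finQ by (simp add: card_PiE k_num_def R_def)
  finally show ?thesis .
qed

text \<open>The weight of a coloring is now the indicator of being constant on every edge. At
  \<open>n = 2\<close> this lets Potts identities determine component counts.\<close>

lemma potts_1_0:
  assumes "finite_multigraph G"
  shows "potts G n 1 0 = of_nat n ^ k_num G"
  unfolding of_nat_power[symmetric] card_monochromatic_colorings[OF assms, symmetric] potts_def
  using finite_colorings[OF assms] finite_edges[OF assms]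
  by (subst of_nat_card_eq_sum_prod) (auto intro!: sum.cong prod.cong)

text \<open>Deletion only removes constraints on colorings; with two colors the counts are powers of
  2, so their exponents compare alike.\<close>

lemma k_num_delete_edge_ge:
  assumes "finite_multigraph G"
  shows "k_num G \<le> k_num (delete_edge G e)"
proof -
  have "2 ^ k_num G \<le> (2::nat) ^ k_num (delete_edge G e)"
    unfolding card_monochromatic_colorings[OF assms, symmetric]
      card_monochromatic_colorings[OF finite_multigraph_delete_edge[OF assms], symmetric]
    using finite_colorings[OF assms] by (intro card_mono) auto
  then show ?thesis by simp
qed

text \<open>Since \<open>2 ^ k(G)\<close> counts the 2-colorings constant on edges, deleting a bridge creates a new such
  coloring, and \<open>S\<close> is one of its color classes.\<close>

lemma is_bridge_iff_cut:
  assumes fin: "finite_multigraph G"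
  shows "is_bridge G e \<longleftrightarrow> e \<in> edges G \<and>
    (\<exists>S. (\<forall>f\<in>edges G - {e}. ends G f \<subseteq> S \<or> ends G f \<inter> S = {}) \<and>
         \<not> (ends G e \<subseteq> S \<or> ends G e \<inter> S = {}))"
proof (cases "e \<in> edges G")
  case True
  define M where "M E = {c \<in> verts G \<rightarrow>\<^sub>E {..<2::nat}. \<forall>f\<in>E. monochromatic c (ends G f)}" for E
  have sub: "M (edges G) \<subseteq> M (edges G - {e})" by (auto simp: M_def)
  have finM: "finite (M E)" for E using finite_colorings[OF fin] by (simp add: M_def)
  have card: "card (M (edges G)) = 2 ^ k_num G"
    "card (M (edges G - {e})) = 2 ^ k_num (delete_edge G e)"
    using card_monochromatic_colorings[OF fin, of 2]
      card_monochromatic_colorings[OF finite_multigraph_delete_edge[OF fin, of e], of 2]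
    by (simp_all add: M_def)
  have "is_bridge G e \<longleftrightarrow> card (M (edges G)) < card (M (edges G - {e}))"
    using True by (simp add: is_bridge_def card)
  also have "\<dots> \<longleftrightarrow> M (edges G) \<noteq> M (edges G - {e})"
    using psubset_card_mono[OF finM] sub by (metis less_irrefl psubsetI)
  also have "\<dots> \<longleftrightarrow> (\<exists>S. (\<forall>f\<in>edges G - {e}. ends G f \<subseteq> S \<or> ends G f \<inter> S = {}) \<and>
         \<not> (ends G e \<subseteq> S \<or> ends G e \<inter> S = {}))" (is "_ \<longleftrightarrow> ?cut")
  proof
    assume "M (edges G) \<noteq> M (edges G - {e})"
    then obtain c where c: "c \<in> M (edges G - {e})" "c \<notin> M (edges G)" using sub by blast
    then have "\<not> monochromatic c (ends G e)" by (auto simp: M_def)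
    then obtain x y where xy: "x \<in> ends G e" "y \<in> ends G e" "c x \<noteq> c y"
      by (auto simp: monochromatic_def)
    have "ends G f \<subseteq> {z. c z = c x} \<or> ends G f \<inter> {z. c z = c x} = {}" if "f \<in> edges G - {e}" for f
    proof (cases "\<exists>z\<in>ends G f. c z = c x")
      case True
      then obtain z where z: "z \<in> ends G f" "c z = c x" by blast
      have "monochromatic c (ends G f)" using c(1) that by (simp add: M_def)
      then have "c z' = c x" if "z' \<in> ends G f" for z'
        using that z unfolding monochromatic_def by metis
      then show ?thesis by blast
    qed blast
    moreover have "\<not> (ends G e \<subseteq> {z. c z = c x} \<or> ends G e \<inter> {z. c z = c x} = {})"
      using xy by auto
    ultimately show ?cut by blast
  next
    assume ?cut
    then obtain S where S: "\<And>f. f \<in> edges G - {e} \<Longrightarrow> ends G f \<subseteq> S \<or> ends G f \<inter> S = {}"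
      "\<not> (ends G e \<subseteq> S \<or> ends G e \<inter> S = {})" by blast
    define c where "c = restrict (\<lambda>x. if x \<in> S then 0 else 1::nat) (verts G)"
    have "monochromatic c (ends G f)" if "f \<in> edges G - {e}" for f
    proof -
      have "ends G f \<subseteq> verts G" using ends_subset_verts[OF fin] that by blast
      with S(1)[OF that] show ?thesis
        by (elim disjE) (auto simp: monochromatic_def c_def)
    qed
    moreover have "\<not> monochromatic c (ends G e)"
    proof -
      obtain x y where "x \<in> ends G e" "x \<notin> S" "y \<in> ends G e" "y \<in> S" using S(2) by blast
      moreover from this have "c x \<noteq> c y"
        using ends_subset_verts[OF fin True] by (simp add: c_def subset_iff)
      ultimately show ?thesis by (auto simp: monochromatic_def)
    qed
    moreover have "c \<in> verts G \<rightarrow>\<^sub>E {..<2}" by (auto simp: c_def)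
    ultimately have "c \<in> M (edges G - {e})" "c \<notin> M (edges G)" using True by (auto simp: M_def)
    then show "M (edges G) \<noteq> M (edges G - {e})" by blast
  qed
  finally show ?thesis using True by simp
qed (simp add: is_bridge_def)

text \<open>No set separates the ends of a loop.\<close>

lemma is_loop_not_bridge:
  assumes "finite_multigraph G" "is_loop G e"
  shows "\<not> is_bridge G e"
proof -
  obtain u where "ends G e = {u}" using assms(2) by (auto simp: is_loop_def card_1_singleton_iff)
  then show ?thesis using is_bridge_iff_cut[OF assms(1)] by auto
qed

text \<open>The cut witnessing that \<open>f\<close> is a bridge survives, having fewer edges to
  respect.\<close>

lemma is_bridge_delete_edge:
  assumes "finite_multigraph G" "is_bridge G f" "f \<noteq> e"
  shows "is_bridge (delete_edge G e) f"
  using assms unfolding is_bridge_iff_cut[OF assms(1)]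
    is_bridge_iff_cut[OF finite_multigraph_delete_edge[OF assms(1)]] by auto

section \<open>Deletion and contraction\<close>

lemma potts_remove_edge:
  assumes "finite_multigraph G" "e \<in> edges G"
  shows "potts G n a b = (\<Sum>c\<in>verts G \<rightarrow>\<^sub>E {..<n}. (if monochromatic c (ends G e) then a else b) *
    (\<Prod>f\<in>edges G - {e}. if monochromatic c (ends G f) then a else b))"
  unfolding potts_def using finite_edges[OF assms(1)] assms(2)
  by (simp add: prod.remove)

lemma potts_loop:
  assumes "finite_multigraph G" "is_loop G e"
  shows "potts G n a b = a * potts (delete_edge G e) n a b"
proof -
  have e: "e \<in> edges G" using assms(2) by (simp add: is_loop_def)
  obtain u where "ends G e = {u}" using assms(2) by (auto simp: is_loop_def card_1_singleton_iff)
  then show ?thesis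
    unfolding potts_remove_edge[OF assms(1) e]
    by (simp add: potts_def monochromatic_def sum_distrib_left)
qed

text \<open>Rotations of the colors by \<open>s\<close> and by \<open>n - s\<close> undo each
  other.\<close>

lemma add_mod_inverse:
  fixes x s t n :: nat
  assumes "x < n" "s + t = n"
  shows "((x + s) mod n + t) mod n = x"
  using assms by (subst mod_add_left_eq) (simp add: add.assoc)

text \<open>Rotating the colors on one side of the cut preserves the weight of all edges but \<open>e\<close> and makes
  the color difference across \<open>e\<close> equidistributed.\<close>

lemma potts_bridge:
  assumes fin: "finite_multigraph G" and br: "is_bridge G e" and n: "n > 0"
  shows "of_nat n * potts G n a b = (a + (of_nat n - 1) * b) * potts (delete_edge G e) n a b"
proof -
  have e: "e \<in> edges G" using br by (simp add: is_bridge_def)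
  obtain S where S: "\<And>f. f \<in> edges G - {e} \<Longrightarrow> ends G f \<subseteq> S \<or> ends G f \<inter> S = {}"
    "\<not> (ends G e \<subseteq> S \<or> ends G e \<inter> S = {})"
    using br unfolding is_bridge_iff_cut[OF fin] by blast
  obtain u w where uw: "ends G e = {u, w}" "u \<in> verts G" "w \<in> verts G" "u \<in> S" "w \<notin> S"
  proof -
    obtain u w where "ends G e = {u, w}" "u \<in> verts G" "w \<in> verts G" using endsE[OF fin e] .
    with S(2) that[of u w] that[of w u] show thesis by (auto simp: insert_commute)
  qed
  let ?X = "verts G \<rightarrow>\<^sub>E {..<n}"
  define W where "W c = (\<Prod>f\<in>edges G - {e}. if monochromatic c (ends G f) then a else b)"
    for c :: "'a \<Rightarrow> nat"
  define shift where "shift s c = restrict (\<lambda>x. if x \<in> S then (c x + s) mod n else c x) (verts G)"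
    for s and c :: "'a \<Rightarrow> nat"
  \<comment> \<open>\<open>D\<close> is the Potts sum without \<open>e\<close>; \<open>M\<close> is
    its part from the colorings under which \<open>e\<close> is monochromatic.\<close>
  define D where "D = (\<Sum>c\<in>?X. W c)"
  define M where "M = (\<Sum>c\<in>?X. W c * of_bool (c u = c w))"
  have inv: "shift t (shift s c) = c"
    if "c \<in> ?X" and "\<And>x. x < n \<Longrightarrow> ((x + s) mod n + t) mod n = x" for s t c
  proof -
    have "c x < n" if "x \<in> verts G" for x using \<open>c \<in> ?X\<close> that by auto
    then have "shift t (shift s c) = restrict c (verts G)"
      unfolding shift_def using that(2) by (intro restrict_ext) simp
    also have "\<dots> = c" using that(1) by (rule PiE_restrict)
    finally show ?thesis .
  qed
  have bij: "bij_betw (shift s) ?X ?X" if "s < n" for s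
  proof (rule bij_betw_byWitness[where f' = "shift (n - s)"])
    show "\<forall>c\<in>?X. shift (n - s) (shift s c) = c" "\<forall>c\<in>?X. shift s (shift (n - s) c) = c"
      using that by (auto intro!: inv add_mod_inverse)
    show "shift s ` ?X \<subseteq> ?X" "shift (n - s) ` ?X \<subseteq> ?X"
      using n by (auto simp: shift_def PiE_iff)
  qed
  \<comment> \<open>Both ends of an edge other than \<open>e\<close> are rotated, or neither
    is.\<close>
  have mono_shift: "monochromatic (shift s c) (ends G f) \<longleftrightarrow> monochromatic c (ends G f)"
    if "f \<in> edges G - {e}" "s < n" "c \<in> ?X" for f s c
  proof -
    have V: "ends G f \<subseteq> verts G" using ends_subset_verts[OF fin] that(1) by blast
    have inj: "(x + s) mod n = (y + s) mod n \<longleftrightarrow> x = y" if "x < n" "y < n" for x y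
      using add_mod_inverse[of _ n s "n - s"] that \<open>s < n\<close> by (metis le_add_diff_inverse less_imp_le)
    have "c x < n" if "x \<in> verts G" for x using \<open>c \<in> ?X\<close> that by auto
    then have "shift s c x = shift s c y \<longleftrightarrow> c x = c y" if "x \<in> ends G f" "y \<in> ends G f" for x y
      using that V S(1)[OF \<open>f \<in> edges G - {e}\<close>] inj[of "c x" "c y"]
      by (auto simp: shift_def subset_iff)
    then show ?thesis by (simp add: monochromatic_def)
  qed
  have W: "W (shift s c) = W c" if "s < n" "c \<in> ?X" for s c
    unfolding W_def using mono_shift that by (intro prod.cong) auto
  \<comment> \<open>The map sending \<open>s\<close> to \<open>(x + s) mod n\<close> permutes the
    residues, so exactly one rotation takes \<open>x\<close> to \<open>y\<close>.\<close>
  have one: "(\<Sum>s<n. of_bool ((x + s) mod n = y)) = (1::complex)" if "x < n" "y < n" for x y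
  proof -
    have "bij_betw (\<lambda>s. (x + s) mod n) {..<n} {..<n}"
    proof (rule bij_betw_byWitness[where f' = "\<lambda>s. (s + (n - x)) mod n"])
      show "\<forall>s\<in>{..<n}. ((x + s) mod n + (n - x)) mod n = s"
        "\<forall>s\<in>{..<n}. (x + (s + (n - x)) mod n) mod n = s"
        using that(1) unfolding add.commute[of x]
        by (intro ballI add_mod_inverse; simp)+
    qed (use n in auto)
    from sum.reindex_bij_betw[OF this, of "\<lambda>s. of_bool (s = y) :: complex"]
    show ?thesis using that(2) by (simp add: of_bool_def)
  qed
  \<comment> \<open>Average over all rotations: each one leaves \<open>M\<close> unchanged, while
    for a fixed coloring exactly one of them makes \<open>e\<close> monochromatic.\<close>
  have "of_nat n * M = (\<Sum>s<n. \<Sum>c\<in>?X. W c * of_bool (c u = c w))" by (simp add: M_def)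
  also have "\<dots> = (\<Sum>s<n. \<Sum>c\<in>?X. W (shift s c) * of_bool (shift s c u = shift s c w))"
    by (intro sum.cong refl sum.reindex_bij_betw[OF bij, symmetric]) simp
  also have "\<dots> = (\<Sum>s<n. \<Sum>c\<in>?X. W c * of_bool ((c u + s) mod n = c w))"
    using uw by (intro sum.cong refl) (simp add: W, simp add: shift_def)
  also have "\<dots> = (\<Sum>c\<in>?X. W c * (\<Sum>s<n. of_bool ((c u + s) mod n = c w)))"
    by (subst sum.swap) (simp only: sum_distrib_left)
  also have "\<dots> = D" unfolding D_def
  proof (intro sum.cong refl)
    fix c assume "c \<in> ?X"
    then have "c u < n" "c w < n" using uw by auto
    then show "W c * (\<Sum>s<n. of_bool ((c u + s) mod n = c w)) = W c" by (simp only: one mult_1_right)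
  qed
  finally have M: "of_nat n * M = D" .
  have "potts G n a b = (\<Sum>c\<in>?X. (if c u = c w then a else b) * W c)"
    unfolding potts_remove_edge[OF fin e] W_def by (simp add: uw monochromatic_doubleton)
  also have "\<dots> = (\<Sum>c\<in>?X. (a - b) * (W c * of_bool (c u = c w)) + b * W c)"
    by (intro sum.cong) (auto simp: algebra_simps)
  also have "\<dots> = (a - b) * M + b * D"
    by (simp add: M_def D_def sum.distrib sum_distrib_left)
  finally have "of_nat n * potts G n a b = of_nat n * ((a - b) * M + b * D)"
    by (simp only:)
  then have "of_nat n * potts G n a b = (a - b) * (of_nat n * M) + b * of_nat n * D"
    by (simp only: algebra_simps)
  moreover have "potts (delete_edge G e) n a b = D"
    by (simp add: potts_def D_def W_def)
  ultimately show ?thesis unfolding M by (simp add: algebra_simps)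
qed

text \<open>Names the end \<open>u\<close> kept by the choice in \<open>contract_edge\<close> and
  the end \<open>w\<close> removed, and simplifies the merging map to one that moves only
  \<open>w\<close>.\<close>

lemma contract_edgeE:
  assumes "finite_multigraph G" "e \<in> edges G" "\<not> is_loop G e"
  obtains u w where "ends G e = {u, w}" "u \<noteq> w" "u \<in> verts G" "w \<in> verts G"
    "contract_edge G e = \<lparr>verts = verts G - {w}, edges = edges G - {e},
       ends = (\<lambda>f. (\<lambda>x. if x = w then u else x) ` ends G f)\<rparr>"
proof -
  define u where "u = (SOME u. u \<in> ends G e)"
  obtain x y where xy: "ends G e = {x, y}" "x \<in> verts G" "y \<in> verts G"
    using endsE[OF assms(1,2)] .
  have "x \<noteq> y" using assms(2,3) xy(1) by (auto simp: is_loop_def)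
  have "u \<in> ends G e" unfolding u_def by (rule someI[of _ x]) (simp add: xy)
  then obtain w where w: "ends G e = {u, w}" "u \<noteq> w"
    using xy \<open>x \<noteq> y\<close> by (cases "u = x") auto
  show thesis
  proof (rule that[OF w])
    show "u \<in> verts G" "w \<in> verts G" using w(1) ends_subset_verts[OF assms(1,2)] by blast+
    have set: "ends G e - {u} = {w}" using w by auto
    have map: "(\<lambda>x. if x \<in> ends G e then u else x) = (\<lambda>x. if x = w then u else x)"
      using w by (auto simp: fun_eq_iff)
    have "contract_edge G e = \<lparr>verts = verts G - (ends G e - {u}), edges = edges G - {e},
       ends = (\<lambda>f. (\<lambda>x. if x \<in> ends G e then u else x) ` ends G f)\<rparr>"
      by (simp only: contract_edge_def Let_def u_def)
    then show "contract_edge G e = \<lparr>verts = verts G - {w}, edges = edges G - {e},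
       ends = (\<lambda>f. (\<lambda>x. if x = w then u else x) ` ends G f)\<rparr>"
      by (simp only: set map)
  qed
qed

lemma finite_multigraph_contract_edge:
  assumes fin: "finite_multigraph G" and e: "e \<in> edges G" "\<not> is_loop G e"
  shows "finite_multigraph (contract_edge G e)"
proof -
  obtain u w where uw: "ends G e = {u, w}" "u \<noteq> w" "u \<in> verts G" "w \<in> verts G"
    "contract_edge G e = \<lparr>verts = verts G - {w}, edges = edges G - {e},
       ends = (\<lambda>f. (\<lambda>x. if x = w then u else x) ` ends G f)\<rparr>"
    using contract_edgeE[OF assms] .
  have "(\<lambda>x. if x = w then u else x) ` ends G f \<subseteq> verts G - {w} \<and>
      (card ((\<lambda>x. if x = w then u else x) ` ends G f) = 1 \<or>
       card ((\<lambda>x. if x = w then u else x) ` ends G f) = 2)"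
    if f: "f \<in> edges G" for f
  proof -
    obtain x y where xy: "ends G f = {x, y}" "x \<in> verts G" "y \<in> verts G" using endsE[OF fin f] .
    show ?thesis unfolding xy(1) image_insert image_empty using uw(2-4) xy(2,3) by (auto simp: card_insert_if)
  qed
  then show ?thesis
    using finite_verts[OF fin] finite_edges[OF fin] by (auto simp: finite_multigraph_def uw(5))
qed

lemma v_num_contract_edge:
  assumes "finite_multigraph G" "e \<in> edges G" "\<not> is_loop G e"
  shows "v_num G = Suc (v_num (contract_edge G e))"
proof -
  obtain w where "w \<in> verts G" "verts (contract_edge G e) = verts G - {w}"
  proof (rule contract_edgeE[OF assms])
    fix u w
    assume "w \<in> verts G" and "contract_edge G e = \<lparr>verts = verts G - {w}, edges = edges G - {e},
       ends = (\<lambda>f. (\<lambda>x. if x = w then u else x) ` ends G f)\<rparr>"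
    then show thesis by (intro that) simp_all
  qed
  then show ?thesis
    using finite_verts[OF assms(1)] by (simp only: v_num_def card_Suc_Diff1)
qed

lemma edges_contract_edge [simp]: "edges (contract_edge G e) = edges G - {e}"
  by (simp add: contract_edge_def Let_def)

text \<open>The factor of \<open>e\<close> is \<open>b\<close> plus \<open>a - b\<close> times the
  indicator that its ends agree, and colorings with agreeing ends are colorings of the contraction.
  Parallel edges become loops there, and have weight \<open>a\<close> on both sides.\<close>

lemma potts_deletion_contraction:
  assumes fin: "finite_multigraph G" and e: "e \<in> edges G" "\<not> is_loop G e"
  shows "potts G n a b =
    b * potts (delete_edge G e) n a b + (a - b) * potts (contract_edge G e) n a b"
proof -
  obtain u w where uw: "ends G e = {u, w}" "u \<noteq> w" "u \<in> verts G" "w \<in> verts G"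
    "contract_edge G e = \<lparr>verts = verts G - {w}, edges = edges G - {e},
       ends = (\<lambda>f. (\<lambda>x. if x = w then u else x) ` ends G f)\<rparr>"
    using contract_edgeE[OF assms] .
  let ?X = "verts G \<rightarrow>\<^sub>E {..<n}" and ?Y = "verts G - {w} \<rightarrow>\<^sub>E {..<n}"
  define h where "h x = (if x = w then u else x)" for x
  define W where "W c = (\<Prod>f\<in>edges G - {e}. if monochromatic c (ends G f) then a else b)"
    for c :: "'a \<Rightarrow> nat"
  \<comment> \<open>Restriction forgets the color of \<open>w\<close>; the inverse recovers it as
    the color of \<open>u\<close> through \<open>h\<close>.\<close>
  have "bij_betw (\<lambda>c. restrict c (verts G - {w})) {c \<in> ?X. c u = c w} ?Y"
  proof (rule bij_betw_byWitness[where f' = "\<lambda>c. restrict (\<lambda>x. c (h x)) (verts G)"], goal_cases)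
    case 1
    have "restrict (\<lambda>x. restrict c (verts G - {w}) (h x)) (verts G) = restrict c (verts G)"
      if "c u = c w" for c :: "'a \<Rightarrow> nat"
      using uw(2-4) that by (auto simp: h_def restrict_def)
    then show ?case by (auto simp: PiE_restrict)
  next
    case 2
    have "restrict (restrict (\<lambda>x. c (h x)) (verts G)) (verts G - {w}) = restrict c (verts G - {w})"
      for c :: "'a \<Rightarrow> nat" by (auto simp: h_def)
    then show ?case by (intro ballI) (simp only: PiE_restrict)
  next
    case 3
    show ?case
    proof (rule image_subsetI)
      fix c assume "c \<in> {c \<in> ?X. c u = c w}"
      then have "\<forall>x\<in>verts G. c x < n" by blast
      then show "restrict c (verts G - {w}) \<in> ?Y" by (simp add: restrict_PiE_iff)
    qed
  next
    case 4
    show ?case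
    proof (rule image_subsetI)
      fix c assume "c \<in> ?Y"
      then have "c x < n" if "x \<in> verts G" "x \<noteq> w" for x using that by blast
      then have "\<forall>x\<in>verts G. c (h x) < n" using uw(2-4) by (simp add: h_def)
      then show "restrict (\<lambda>x. c (h x)) (verts G) \<in> {c \<in> ?X. c u = c w}"
        using uw(2-4) by (simp add: restrict_PiE_iff h_def)
    qed
  qed
  note reindex = sum.reindex_bij_betw[OF this]
  have "W c = (\<Prod>f\<in>edges G - {e}.
      if monochromatic (restrict c (verts G - {w})) (h ` ends G f) then a else b)"
    if "c \<in> ?X" "c u = c w" for c
    unfolding W_def
  proof (intro prod.cong refl)
    fix f assume "f \<in> edges G - {e}"
    then have "ends G f \<subseteq> verts G" using ends_subset_verts[OF fin] by blast
    then have "monochromatic (\<lambda>x. restrict c (verts G - {w}) (h x)) (ends G f) \<longleftrightarrow>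
        monochromatic c (ends G f)"
      using uw(2-4) that by (intro monochromatic_cong) (auto simp: h_def)
    then show "(if monochromatic c (ends G f) then a else b) =
      (if monochromatic (restrict c (verts G - {w})) (h ` ends G f) then a else b)"
      by (simp only: monochromatic_comp)
  qed
  then have "(\<Sum>c | c \<in> ?X \<and> c u = c w. W c) = (\<Sum>c | c \<in> ?X \<and> c u = c w. \<Prod>f\<in>edges G - {e}.
      if monochromatic (restrict c (verts G - {w})) (h ` ends G f) then a else b)"
    by (intro sum.cong) auto
  also have "\<dots> = (\<Sum>c\<in>?Y. \<Prod>f\<in>edges G - {e}. if monochromatic c (h ` ends G f) then a else b)"
    by (rule reindex)
  also have "\<dots> = potts (contract_edge G e) n a b"
    by (simp only: potts_def uw(5) multigraph.select_convs h_def[abs_def])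
  finally have "potts (contract_edge G e) n a b = (\<Sum>c | c \<in> ?X \<and> c u = c w. W c)" ..
  also have "\<dots> = (\<Sum>c\<in>?X. if c u = c w then W c else 0)"
    using finite_colorings[OF fin] by (simp add: sum.inter_filter)
  finally have C: "potts (contract_edge G e) n a b = (\<Sum>c\<in>?X. if c u = c w then W c else 0)" .
  have D: "potts (delete_edge G e) n a b = (\<Sum>c\<in>?X. W c)"
    by (simp add: potts_def W_def)
  have "potts G n a b = (\<Sum>c\<in>?X. (if c u = c w then a else b) * W c)"
    unfolding potts_remove_edge[OF fin e(1)] W_def by (simp add: uw monochromatic_doubleton)
  also have "\<dots> = (\<Sum>c\<in>?X. b * W c + (a - b) * (if c u = c w then W c else 0))"
    by (intro sum.cong) (auto simp: algebra_simps)
  also have "\<dots> = b * potts (delete_edge G e) n a b + (a - b) * potts (contract_edge G e) n a b"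
    by (simp only: C D sum.distrib sum_distrib_left)
  finally show ?thesis .
qed

text \<open>With weights 1 and 0 the deletion term vanishes, leaving equal Potts sums at two
  colors.\<close>

lemma k_num_contract_edge:
  assumes "finite_multigraph G" "e \<in> edges G" "\<not> is_loop G e"
  shows "k_num (contract_edge G e) = k_num G"
proof -
  have "potts G 2 1 0 = potts (contract_edge G e) 2 1 0"
    using potts_deletion_contraction[OF assms] by simp
  then have "(of_nat (2 ^ k_num G) :: complex) = of_nat (2 ^ k_num (contract_edge G e))"
    using potts_1_0[OF assms(1), of 2] potts_1_0[OF finite_multigraph_contract_edge[OF assms], of 2]
    by simp
  then show ?thesis unfolding of_nat_eq_iff by simp
qed

lemma k_num_delete_nonbridge:
  assumes "finite_multigraph G" "e \<in> edges G" "\<not> is_bridge G e"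
  shows "k_num (delete_edge G e) = k_num G"
  using k_num_delete_edge_ge[OF assms(1), of e] assms(2,3) by (simp add: is_bridge_def)

text \<open>Removing the edges one at a time splits off a factor for each bridge or loop, down to
  the edgeless graph with its \<open>n ^ v_num G\<close> colorings.\<close>

lemma potts_bridges_loops:
  assumes "finite_multigraph G" "n > 0" "\<And>e. e \<in> edges G \<Longrightarrow> is_bridge G e \<or> is_loop G e"
  shows "potts G n a b = of_nat n ^ v_num G
    * ((a + (of_nat n - 1) * b) / of_nat n) ^ card {e \<in> edges G. is_bridge G e}
    * a ^ card {e \<in> edges G. is_loop G e}"
  using assms(1,3)
proof (induction "card (edges G)" arbitrary: G)
  case 0
  then have "edges G = {}" using finite_edges[OF 0(2)] by simp
  then show ?case
    using finite_verts[OF 0(2)] by (simp add: potts_def card_PiE v_num_def)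
next
  case (Suc m)
  note fin = Suc.prems(1)
  let ?B = "\<lambda>G. {e \<in> edges G. is_bridge G e}" and ?L = "\<lambda>G. {e \<in> edges G. is_loop G e}"
  obtain e where e: "e \<in> edges G" using Suc.hyps(2) by fastforce
  have loop: "is_loop (delete_edge G e) f \<longleftrightarrow> is_loop G f \<and> f \<noteq> e" for f
    by (auto simp: is_loop_def)
  \<comment> \<open>No new bridge arises: every edge is a bridge or a loop, and a loop remains a
    loop, which is never a bridge.\<close>
  have br: "is_bridge (delete_edge G e) f \<longleftrightarrow> is_bridge G f" if "f \<in> edges G" "f \<noteq> e" for f
    using that Suc.prems(2)[OF that(1)] loop[of f] is_loop_not_bridge[OF fin]
      is_loop_not_bridge[OF finite_multigraph_delete_edge[OF fin]] is_bridge_delete_edge[OF fin]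
    by blast
  have B: "?B (delete_edge G e) = ?B G - {e}" using br by auto
  have L: "?L (delete_edge G e) = ?L G - {e}" using loop by auto
  have cards: "finite (?B G)" "finite (?L G)" using finite_edges[OF fin] by auto
  have v: "v_num (delete_edge G e) = v_num G" by (simp add: v_num_def)
  have IH: "potts (delete_edge G e) n a b = of_nat n ^ v_num G
    * ((a + (of_nat n - 1) * b) / of_nat n) ^ card (?B G - {e}) * a ^ card (?L G - {e})"
    unfolding B[symmetric] L[symmetric] v[symmetric]
  proof (rule Suc.hyps(1)[OF _ finite_multigraph_delete_edge[OF fin]])
    show "m = card (edges (delete_edge G e))"
      using Suc.hyps(2) e by simp
    show "is_bridge (delete_edge G e) f \<or> is_loop (delete_edge G e) f"
      if "f \<in> edges (delete_edge G e)" for f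
      using Suc.prems(2)[of f] br loop that by auto
  qed
  show ?case
  proof (cases "is_loop G e")
    case True
    then have "?B G - {e} = ?B G" "card (?L G) = Suc (card (?L G - {e}))"
      using is_loop_not_bridge[OF fin] e card_Suc_Diff1[OF cards(2), of e] by auto
    then show ?thesis
      unfolding potts_loop[OF fin True] IH by simp
  next
    case False
    then have be: "is_bridge G e" using Suc.prems(2)[OF e] by blast
    then have card: "?L G - {e} = ?L G" "card (?B G) = Suc (card (?B G - {e}))"
      using False e card_Suc_Diff1[OF cards(1), of e] by auto
    have "potts G n a b = (a + (of_nat n - 1) * b) / of_nat n * potts (delete_edge G e) n a b"
      using potts_bridge[OF fin be assms(2), of a b] assms(2) by (simp add: field_simps)
    then show ?thesis unfolding IH card by simp
  qed
qed

text \<open>With weights 1 and 0 and two colors each bridge halves the Potts sum, so the exponents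
  of 2 give the relation.\<close>

lemma k_num_bridges_loops:
  assumes "finite_multigraph G" "\<And>e. e \<in> edges G \<Longrightarrow> is_bridge G e \<or> is_loop G e"
  shows "k_num G + card {e \<in> edges G. is_bridge G e} = v_num G"
proof -
  let ?i = "card {e \<in> edges G. is_bridge G e}"
  have "(2::complex) ^ k_num G = 2 ^ v_num G * (1 / 2) ^ ?i"
    using potts_bridges_loops[OF assms(1) _ assms(2), of 2 1 0] potts_1_0[OF assms(1), of 2] by simp
  then have "(of_nat (2 ^ (k_num G + ?i)) :: complex) = of_nat (2 ^ v_num G)"
    by (simp add: power_add field_simps)
  then show ?thesis unfolding of_nat_eq_iff by simp
qed

section \<open>The Tutte polynomial\<close>

text \<open>The prefactor that turns the Tutte recursion into the weighted recursion of the Potts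
  sum.\<close>

definition tutte_scale :: "('v, 'e) multigraph \<Rightarrow> nat \<Rightarrow> complex \<Rightarrow> complex \<Rightarrow> complex" where
  "tutte_scale G n a b = of_nat n ^ k_num G * b powi c_num G * (a - b) powi r_num G"

text \<open>Deleting \<open>e\<close> lowers \<open>c_num\<close> by 1 and keeps
  \<open>r_num\<close>; contracting it does the opposite. The scale thus releases exactly the
  coefficients \<open>b\<close> and \<open>a - b\<close> of the Potts recursion. Stated for every
  related \<open>P\<close>, since uniqueness is derived from it.\<close>

lemma tutte_rel_potts:
  assumes "tutte_rel G P" "finite_multigraph G" "n > 0" "a - b \<noteq> 0" "b \<noteq> 0"
  shows "tutte_scale G n a b * poly (poly P [:a / b:]) ((a + (of_nat n - 1) * b) / (a - b))
    = potts G n a b"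
  using assms(1,2)
proof (induction rule: tutte_rel.induct)
  case (bridges_loops G)
  let ?B = "{e \<in> edges G. is_bridge G e}" and ?L = "{e \<in> edges G. is_loop G e}"
  have v: "v_num G = k_num G + card ?B"
    using k_num_bridges_loops[OF bridges_loops(2,1)] by simp
  have "edges G = ?B \<union> ?L" "?B \<inter> ?L = {}"
    using bridges_loops(1) is_loop_not_bridge[OF bridges_loops(2)] by auto
  then have "e_num G = card ?B + card ?L"
    unfolding e_num_def using finite_edges[OF bridges_loops(2)]
    by (metis (no_types, lifting) card_Un_disjoint finite_Un)
  then have "c_num G = int (card ?L)" "r_num G = int (card ?B)"
    using v by (simp_all add: c_num_def r_num_def)
  moreover have "potts G n a b = of_nat n ^ v_num G
    * ((a + (of_nat n - 1) * b) / of_nat n) ^ card ?B * a ^ card ?L"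
    using potts_bridges_loops[OF bridges_loops(2) assms(3) bridges_loops(1)] .
  \<comment> \<open>The extra \<open>n\<close> per bridge in \<open>n ^ v_num G\<close> cancels the
    denominator of its Potts factor; the powers of \<open>a - b\<close> and \<open>b\<close> in the
    scale cancel the denominators of the Tutte arguments.\<close>
  ultimately show ?case
    using assms(3-5)
    by (simp add: tutte_scale_def v var_x_def var_y_def poly_power power_add power_divide)
next
  case (deletion_contraction e G P Q)
  note fin = \<open>finite_multigraph G\<close> and e = \<open>e \<in> edges G\<close> \<open>\<not> is_loop G e\<close>
  have k: "k_num (delete_edge G e) = k_num G" "k_num (contract_edge G e) = k_num G"
    using k_num_delete_nonbridge[OF fin e(1)] k_num_contract_edge[OF fin e] deletion_contraction.hyps
    by auto
  have en: "e_num (delete_edge G e) = e_num G - 1" "e_num (contract_edge G e) = e_num G - 1" "e_num G > 0"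
    using e(1) finite_edges[OF fin] by (auto simp: e_num_def card_gt_0_iff)
  have v: "v_num (delete_edge G e) = v_num G" "v_num G = Suc (v_num (contract_edge G e))"
    using v_num_contract_edge[OF fin e] by (simp_all add: v_num_def)
  have "r_num (delete_edge G e) = r_num G" "c_num G = c_num (delete_edge G e) + 1"
    using k(1) en v(1) by (auto simp: r_num_def c_num_def)
  then have 1: "tutte_scale G n a b = b * tutte_scale (delete_edge G e) n a b"
    using assms(5) by (simp add: tutte_scale_def k power_int_add)
  have "r_num G = r_num (contract_edge G e) + 1" "c_num G = c_num (contract_edge G e)"
    using k(2) en v(2) by (auto simp: r_num_def c_num_def)
  then have 2: "tutte_scale G n a b = (a - b) * tutte_scale (contract_edge G e) n a b"
    using assms(4) by (simp add: tutte_scale_def k power_int_add)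
  show ?case
    unfolding potts_deletion_contraction[OF fin e]
      deletion_contraction.IH(1)[OF finite_multigraph_delete_edge[OF fin], symmetric]
      deletion_contraction.IH(2)[OF finite_multigraph_contract_edge[OF fin e], symmetric]
      poly_add distrib_left mult.assoc[symmetric] 1[symmetric] 2[symmetric] ..
qed

section \<open>Well-definedness of the Tutte polynomial\<close>

lemma tutte_rel_exists:
  assumes "finite_multigraph G"
  shows "\<exists>P. tutte_rel G P"
  using assms
proof (induction "card (edges G)" arbitrary: G rule: less_induct)
  case less
  show ?case
  proof (cases "\<forall>e\<in>edges G. is_bridge G e \<or> is_loop G e")
    case True
    then have "tutte_rel G (var_x ^ card {e \<in> edges G. is_bridge G e} *
        var_y ^ card {e \<in> edges G. is_loop G e})"
      by (intro tutte_rel.bridges_loops) (rule bspec)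
    then show ?thesis ..
  next
    case False
    then obtain e where e: "e \<in> edges G" "\<not> is_bridge G e" "\<not> is_loop G e" by blast
    have "card (edges G - {e}) < card (edges G)"
      using e(1) finite_edges[OF less.prems] by (rule card_Diff1_less[rotated])
    then obtain P Q where "tutte_rel (delete_edge G e) P" "tutte_rel (contract_edge G e) Q"
      using less.hyps[of "delete_edge G e"] less.hyps[of "contract_edge G e"]
        finite_multigraph_delete_edge[OF less.prems]
        finite_multigraph_contract_edge[OF less.prems e(1,3)] by auto
    then have "tutte_rel G (P + Q)" by (rule tutte_rel.deletion_contraction[OF e])
    then show ?thesis ..
  qed
qed

text \<open>Stated over an integral domain because it is applied twice: to the outer polynomial in
  \<open>y\<close>, at constant polynomials, and then to the inner one in \<open>x\<close>.\<close>

lemma poly_eqI_infinite: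
  fixes p q :: "'a :: idom poly"
  assumes "infinite X" "\<And>x. x \<in> X \<Longrightarrow> poly p x = poly q x"
  shows "p = q"
proof (rule ccontr)
  assume "p \<noteq> q"
  then have "finite {x. poly (p - q) x = 0}" by (intro poly_roots_finite) simp
  moreover have "X \<subseteq> {x. poly (p - q) x = 0}" using assms(2) by auto
  ultimately show False using assms(1) finite_subset by blast
qed

text \<open>The points \<open>(x, y)\<close> with \<open>(x - 1) (y - 1)\<close> a positive integer are Zariski dense, and there
  the value of the polynomial is determined by the Potts sum.\<close>

lemma tutte_rel_unique:
  assumes "finite_multigraph G" "tutte_rel G P" "tutte_rel G Q"
  shows "P = Q"
proof (rule poly_eqI_infinite)
  let ?Y = "(\<lambda>y. [:y:]) ` (- {1 :: complex})"
  have "infinite (- {1 :: complex})" by (simp add: infinite_UNIV_char_0 Compl_eq_Diff_UNIV)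
  then show "infinite ?Y" by (simp add: finite_image_iff inj_on_def)
  fix z assume "z \<in> ?Y"
  then obtain y where y: "z = [:y:]" "y \<noteq> 1" by blast
  show "poly P z = poly Q z"
  proof (rule poly_eqI_infinite)
    \<comment> \<open>The solution \<open>x\<close> of \<open>(x - 1) * (y - 1) = n\<close>, which
      is the first Tutte argument for the weights \<open>y\<close> and 1.\<close>
    let ?x = "\<lambda>n. (y + (of_nat n - 1)) / (y - 1)"
    have "inj_on ?x {0<..}" using y(2) by (auto simp: inj_on_def)
    then show "infinite (?x ` {0<..})" by (simp add: finite_image_iff infinite_Ioi)
    fix x assume "x \<in> ?x ` {0<..}"
    then obtain n where n: "x = ?x n" "n > 0" by blast
    have "tutte_scale G n y 1 \<noteq> 0" using n y by (simp add: tutte_scale_def)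
    moreover have "tutte_scale G n y 1 * poly (poly P z) x = tutte_scale G n y 1 * poly (poly Q z) x"
      using tutte_rel_potts[OF assms(2,1) n(2), of y 1] tutte_rel_potts[OF assms(3,1) n(2), of y 1] y n
      by simp
    ultimately show "poly (poly P z) x = poly (poly Q z) x" by simp
  qed
qed

lemma tutte_potts:
  assumes "finite_multigraph G" "n > 0" "a - b \<noteq> 0" "b \<noteq> 0"
  shows "tutte_scale G n a b * tutte G ((a + (of_nat n - 1) * b) / (a - b)) (a / b) = potts G n a b"
proof -
  have "tutte_rel G (tutte_poly G)"
    unfolding tutte_poly_def
    using tutte_rel_exists[OF assms(1)] tutte_rel_unique[OF assms(1)] by (metis theI)
  from tutte_rel_potts[OF this assms] show ?thesis by (simp add: tutte_def)
qed

section \<open>Flows\<close>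

definition character :: "nat \<Rightarrow> int \<Rightarrow> complex" where
  "character n m = cis (2 * pi * real_of_int m / real n)"

lemma character_0 [simp]: "character n 0 = 1"
  by (simp add: character_def)

lemma character_add: "character n (l + m) = character n l * character n m"
  by (simp add: character_def cis_mult add_divide_distrib distrib_left)

lemma character_sum: "character n (sum f X) = (\<Prod>x\<in>X. character n (f x))"
  by (induction X rule: infinite_finite_induct) (simp_all add: character_add)

lemma character_mult_nat: "character n (int k * m) = character n m ^ k"
  by (simp add: character_def DeMoivre mult_ac)

lemma character_eq_1_iff:
  assumes "n > 0"
  shows "character n m = 1 \<longleftrightarrow> int n dvd m"
proof
  assume "character n m = 1"
  then have "cos (2 * pi * real_of_int m / real n) = 1"
    by (simp add: character_def complex_eq_iff)
  then obtain k :: int where "2 * pi * real_of_int m / real n = real_of_int k * 2 * pi"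
    by (auto simp: cos_one_2pi_int)
  then have "real_of_int m = real_of_int (k * int n)"
    using assms by (simp add: field_simps)
  then show "int n dvd m" by (metis dvd_triv_right of_int_eq_iff)
next
  assume "int n dvd m"
  then obtain k where "m = int n * k" by blast
  then have "character n m = cis (2 * pi * real_of_int k)"
    using assms by (simp add: character_def mult.assoc del: cis_multiple_2pi)
  then show "character n m = 1" by (metis Ints_of_int cis_multiple_2pi)
qed

text \<open>Orthogonality: unless all terms are 1, this is a full geometric sum whose ratio is an
  \<open>n\<close>-th root of unity other than 1.\<close>

lemma sum_character:
  assumes "n > 0"
  shows "(\<Sum>k<n. character n (int k * m)) = (if int n dvd m then of_nat n else 0)"
proof (cases "int n dvd m")
  case True
  then show ?thesis
    using character_eq_1_iff[OF assms, of m] by (simp add: character_mult_nat)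
next
  case False
  have "character n m ^ n = 1"
    unfolding character_mult_nat[symmetric] character_eq_1_iff[OF assms] by simp
  then show ?thesis
    using False character_eq_1_iff[OF assms, of m] by (simp add: character_mult_nat sum_gp_strict)
qed

text \<open>Dropping the term at 0 subtracts 1; this is where the flow weights \<open>n - 1\<close>
  and \<open>- 1\<close> come from.\<close>

lemma sum_nonzero_character:
  assumes "n > 0"
  shows "(\<Sum>k\<in>{1..<n}. character n (int k * m)) = (if int n dvd m then of_nat n - 1 else - 1)"
proof -
  have "(\<Sum>k<n. character n (int k * m)) = 1 + (\<Sum>k\<in>{1..<n}. character n (int k * m))"
    using assms by (simp add: lessThan_atLeast0 sum.atLeast_Suc_lessThan)
  then have "(\<Sum>k\<in>{1..<n}. character n (int k * m)) = (\<Sum>k<n. character n (int k * m)) - 1"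
    by (simp only: add_diff_cancel_left')
  then show ?thesis by (simp only: sum_character[OF assms] split: if_split) simp
qed

text \<open>Orthogonality of characters detects conservation at each vertex. The frequencies at the
  vertices form a coloring, and after exchanging the sums each edge sums a character of its color
  difference over the nonzero values of the flow.\<close>

lemma flow_potts:
  assumes fin: "finite_multigraph G" and n: "n > 0"
  shows "of_nat n ^ v_num G * of_nat (flow G n) = potts G n (of_nat n - 1) (- 1)"
proof -
  obtain d where d: "orientation G d" using orientation_exists[OF fin] by blast
  let ?V = "verts G" and ?E = "edges G"
  let ?D = "\<lambda>e v. of_bool (snd (d e) = v) - of_bool (fst (d e) = v) :: int"
  have finV: "finite ?V" and finE: "finite ?E" using finite_verts[OF fin] finite_edges[OF fin] .
  have delta: "(\<Sum>v\<in>?V. int (c v) * of_bool (x = v)) = int (c x)" if "x \<in> ?V" for c x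
    using finV that by (simp add: of_bool_def if_distrib[where f = "times _"] cong: if_cong)
  have "of_nat (flow G n) = (of_nat (card {f \<in> ?E \<rightarrow>\<^sub>E {1..<n}.
      \<forall>v\<in>?V. int n dvd (\<Sum>e\<in>?E. int (f e) * ?D e v)}) :: complex)"
    unfolding flow_eq[OF fin d]
    by (rule arg_cong[where f = "\<lambda>X. of_nat (card X)"])
      (intro set_eqI, simp only: nowhere_zero_flows_alt[OF finE] mem_Collect_eq)
  also have "\<dots> = (\<Sum>f\<in>?E \<rightarrow>\<^sub>E {1..<n}. \<Prod>v\<in>?V. of_bool (int n dvd (\<Sum>e\<in>?E. int (f e) * ?D e v)))"
    using finV finE by (intro of_nat_card_eq_sum_prod finite_PiE) auto
  finally have "of_nat n ^ v_num G * of_nat (flow G n) = (\<Sum>f\<in>?E \<rightarrow>\<^sub>E {1..<n}.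
      \<Prod>v\<in>?V. of_nat n * of_bool (int n dvd (\<Sum>e\<in>?E. int (f e) * ?D e v)) :: complex)"
    by (simp only: prod.distrib prod_constant v_num_def sum_distrib_left)
  also have "\<dots> = (\<Sum>f\<in>?E \<rightarrow>\<^sub>E {1..<n}. \<Prod>v\<in>?V.
      \<Sum>k<n. character n (int k * (\<Sum>e\<in>?E. int (f e) * ?D e v)))"
    by (intro sum.cong prod.cong refl) (simp add: sum_character[OF n])
  \<comment> \<open>Multiplying out over the vertices collects the chosen frequencies into a
    coloring \<open>c\<close>.\<close>
  also have "\<dots> = (\<Sum>f\<in>?E \<rightarrow>\<^sub>E {1..<n}. \<Sum>c\<in>?V \<rightarrow>\<^sub>E {..<n}.
      \<Prod>v\<in>?V. character n (int (c v) * (\<Sum>e\<in>?E. int (f e) * ?D e v)))"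
    using finV by (intro sum.cong refl prod_sum_PiE) auto
  also have "\<dots> = (\<Sum>f\<in>?E \<rightarrow>\<^sub>E {1..<n}. \<Sum>c\<in>?V \<rightarrow>\<^sub>E {..<n}.
      \<Prod>e\<in>?E. character n (int (f e) * (int (c (snd (d e))) - int (c (fst (d e))))))"
  proof (intro sum.cong refl)
    fix f :: "'b \<Rightarrow> nat" and c :: "'a \<Rightarrow> nat"
    \<comment> \<open>Summation by parts: pairing the coloring with the net flow at vertices equals
      pairing the flow with the color differences along edges.\<close>
    have "(\<Sum>v\<in>?V. int (c v) * (\<Sum>e\<in>?E. int (f e) * ?D e v)) =
        (\<Sum>e\<in>?E. int (f e) * (\<Sum>v\<in>?V. int (c v) * ?D e v))"
      unfolding sum_distrib_left by (subst sum.swap) (simp only: mult.left_commute)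
    also have "\<dots> = (\<Sum>e\<in>?E. int (f e) * (int (c (snd (d e))) - int (c (fst (d e)))))"
    proof (intro sum.cong refl arg_cong2[where f = times])
      fix e assume "e \<in> ?E"
      then have "fst (d e) \<in> ?V" "snd (d e) \<in> ?V"
        using d ends_subset_verts[OF fin, of e] by (auto simp: orientation_def)
      then show "(\<Sum>v\<in>?V. int (c v) * ?D e v) = int (c (snd (d e))) - int (c (fst (d e)))"
        by (simp only: right_diff_distrib sum_subtractf delta)
    qed
    finally show "(\<Prod>v\<in>?V. character n (int (c v) * (\<Sum>e\<in>?E. int (f e) * ?D e v))) =
        (\<Prod>e\<in>?E. character n (int (f e) * (int (c (snd (d e))) - int (c (fst (d e))))))"
      by (simp only: character_sum[symmetric])
  qed
  also have "\<dots> = (\<Sum>c\<in>?V \<rightarrow>\<^sub>E {..<n}. \<Sum>f\<in>?E \<rightarrow>\<^sub>E {1..<n}.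
      \<Prod>e\<in>?E. character n (int (f e) * (int (c (snd (d e))) - int (c (fst (d e))))))"
    by (rule sum.swap)
  also have "\<dots> = (\<Sum>c\<in>?V \<rightarrow>\<^sub>E {..<n}. \<Prod>e\<in>?E. \<Sum>k\<in>{1..<n}.
      character n (int k * (int (c (snd (d e))) - int (c (fst (d e))))))"
    using finE by (intro sum.cong refl prod_sum_PiE[symmetric]) auto
  also have "\<dots> = potts G n (of_nat n - 1) (- 1)"
    unfolding potts_def
  proof (intro sum.cong prod.cong refl)
    fix c e assume c: "c \<in> ?V \<rightarrow>\<^sub>E {..<n}" and e: "e \<in> ?E"
    have ends: "ends G e = {fst (d e), snd (d e)}" using d e by (simp add: orientation_def)
    then have "c (fst (d e)) < n" "c (snd (d e)) < n"
      using c ends_subset_verts[OF fin e] by auto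
    \<comment> \<open>Both colors lie below \<open>n\<close>, so congruent means equal.\<close>
    then have "int n dvd int (c (snd (d e))) - int (c (fst (d e))) \<longleftrightarrow> c (fst (d e)) = c (snd (d e))"
      by (auto simp: mod_eq_dvd_iff[symmetric])
    then show "(\<Sum>k\<in>{1..<n}. character n (int k * (int (c (snd (d e))) - int (c (fst (d e)))))) =
      (if monochromatic c (ends G e) then of_nat n - 1 else - 1)"
      by (simp only: sum_nonzero_character[OF n] ends monochromatic_doubleton)
  qed
  finally show ?thesis .
qed

section \<open>Sums over spanning subgraphs\<close>

lemma finite_multigraph_spanning_subgraph:
  "finite_multigraph G \<Longrightarrow> A \<in> spanning_subgraphs G \<Longrightarrow> finite_multigraph A"
  by (auto simp: spanning_subgraphs_def intro: finite_multigraph_edges_upd)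

lemma v_num_spanning_subgraph: "A \<in> spanning_subgraphs G \<Longrightarrow> v_num A = v_num G"
  by (auto simp: spanning_subgraphs_def v_num_def)

lemma e_num_spanning_subgraph_le:
  "finite_multigraph G \<Longrightarrow> A \<in> spanning_subgraphs G \<Longrightarrow> e_num A \<le> e_num G"
  by (auto simp: spanning_subgraphs_def e_num_def intro!: card_mono dest: finite_edges)

text \<open>The convolution in the form of the four formulas. The alternative
  \<open>e_num G = 0\<close> covers the second formula at \<open>n = 1\<close>, where
  \<open>q\<close> is 0 and the assumption on denominators forces an edgeless graph.\<close>

lemma spanning_convolution_quotient:
  assumes "finite_multigraph G" "q \<noteq> 0 \<or> e_num G = 0"
  shows "q ^ e_num G * (\<Sum>A\<in>spanning_subgraphs G. (p / q) ^ e_num A * potts A n a b)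
    = potts G n (p * a + q) (p * b + q)"
proof -
  have "q ^ e_num G * ((p / q) ^ e_num A * x) = p ^ e_num A * q ^ (e_num G - e_num A) * x"
    if "A \<in> spanning_subgraphs G" for A x
    using e_num_spanning_subgraph_le[OF assms(1) that] assms(2)
    by (auto simp: power_divide power_diff field_simps)
  then show ?thesis
    unfolding spanning_convolution[OF assms(1), symmetric] sum_distrib_left
    by (intro sum.cong) auto
qed

section \<open>The four formulas as substitutions of weights\<close>

theorem theorem2p19:
  fixes G :: "('v, 'e) multigraph" and n :: nat and \<alpha> \<beta> :: complex
  assumes "finite_multigraph G" and "n > 0"
  shows
    "(let p = - \<alpha> + \<beta>; q = \<alpha> in
        \<alpha> - \<beta> \<noteq> 0 \<longrightarrow> \<beta> \<noteq> 0 \<longrightarrow> q \<noteq> 0 \<longrightarrow>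
        of_nat n ^ k_num G * \<beta> powi c_num G * (\<alpha> - \<beta>) powi r_num G
          * tutte G ((\<alpha> + (of_nat n - 1) * \<beta>) / (\<alpha> - \<beta>)) (\<alpha> / \<beta>)
        = q ^ e_num G * (\<Sum>A\<in>spanning_subgraphs G. (p / q) ^ e_num A * of_nat (chromatic A n)))
   \<and> ((\<forall>A\<in>spanning_subgraphs G. (1 - of_nat n :: complex) ^ e_num A \<noteq> 0) \<longrightarrow>
        (of_nat (flow G n) :: complex)
        = (of_nat n - 1) ^ e_num G
          * (\<Sum>A\<in>spanning_subgraphs G.
               of_nat n powi (int (e_num A) - int (v_num G)) / (1 - of_nat n) ^ e_num A
               * of_nat (chromatic A n)))
   \<and> (let p\<^sub>1 = (\<beta> - \<alpha>) / of_nat n; q\<^sub>1 = (\<alpha> - (1 - of_nat n) * \<beta>) / of_nat n in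
        \<alpha> - \<beta> \<noteq> 0 \<longrightarrow> \<beta> \<noteq> 0 \<longrightarrow> q\<^sub>1 \<noteq> 0 \<longrightarrow>
        of_nat n powi (int (k_num G) - int (v_num G)) * \<beta> powi c_num G * (\<alpha> - \<beta>) powi r_num G
          * tutte G ((\<alpha> + (of_nat n - 1) * \<beta>) / (\<alpha> - \<beta>)) (\<alpha> / \<beta>)
        = q\<^sub>1 ^ e_num G
          * (\<Sum>A\<in>spanning_subgraphs G. (p\<^sub>1 / q\<^sub>1) ^ e_num A * (- 1) ^ e_num A * of_nat (flow A n)))
   \<and> (let p\<^sub>2 = of_nat n / (\<beta> - \<alpha>); q\<^sub>2 = (\<alpha> - (1 - of_nat n) * \<beta>) / (\<alpha> - \<beta>) in
        \<alpha> - \<beta> \<noteq> 0 \<longrightarrow> \<beta> \<noteq> 0 \<longrightarrow> q\<^sub>2 \<noteq> 0 \<longrightarrow>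
        (- 1) ^ e_num G * of_nat (flow G n)
        = q\<^sub>2 ^ e_num G
          * (\<Sum>A\<in>spanning_subgraphs G.
               (p\<^sub>2 / q\<^sub>2) ^ e_num A * of_nat n powi (int (k_num A) - int (v_num G))
               * \<beta> powi c_num A * (\<alpha> - \<beta>) powi r_num A
               * tutte A ((\<alpha> + (of_nat n - 1) * \<beta>) / (\<alpha> - \<beta>)) (\<alpha> / \<beta>)))"
proof -
  note fin = assms(1)
  have n: "(of_nat n :: complex) \<noteq> 0" using assms(2) by simp
  let ?x = "(\<alpha> + (of_nat n - 1) * \<beta>) / (\<alpha> - \<beta>)" and ?y = "\<alpha> / \<beta>"
  have tutte: "of_nat n ^ k_num H * \<beta> powi c_num H * (\<alpha> - \<beta>) powi r_num H * tutte H ?x ?y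
      = potts H n \<alpha> \<beta>"
    if "finite_multigraph H" "\<alpha> - \<beta> \<noteq> 0" "\<beta> \<noteq> 0" for H :: "('v, 'e) multigraph"
    using tutte_potts[OF that(1) assms(2) that(2,3)] by (simp only: tutte_scale_def)
  have powi: "(of_nat n :: complex) powi (int k - int (v_num G)) = of_nat n ^ k / of_nat n ^ v_num G" for k
    using n by (simp add: power_int_diff)
  have tutte': "of_nat n powi (int (k_num H) - int (v_num G)) * \<beta> powi c_num H
      * (\<alpha> - \<beta>) powi r_num H * tutte H ?x ?y = potts H n \<alpha> \<beta> / of_nat n ^ v_num G"
    if "finite_multigraph H" "\<alpha> - \<beta> \<noteq> 0" "\<beta> \<noteq> 0" for H :: "('v, 'e) multigraph"
    unfolding tutte[OF that, symmetric] powi by simp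
  have chrom: "of_nat (chromatic A n) = potts A n 0 1" if "A \<in> spanning_subgraphs G" for A
    using chromatic_potts[OF finite_multigraph_spanning_subgraph[OF fin that]] .
  \<comment> \<open>All spanning subgraphs have the vertices of \<open>G\<close>, so the power of
    \<open>n\<close> is common to all of them and leaves the sum.\<close>
  have flow: "of_nat (flow A n) = potts A n (of_nat n - 1) (- 1) / of_nat n ^ v_num G"
    if "A \<in> spanning_subgraphs G" for A
    using flow_potts[OF finite_multigraph_spanning_subgraph[OF fin that] assms(2)] n
      v_num_spanning_subgraph[OF that] by (simp add: field_simps)
  have G: "G \<in> spanning_subgraphs G"
    by (auto simp: spanning_subgraphs_def intro!: image_eqI[where x = "edges G"])
  note conv = spanning_convolution_quotient[OF fin, where n = n]
  show ?thesis
    unfolding Let_def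
  proof (intro conjI impI, goal_cases)
    case 1
    \<comment> \<open>The affine map with slope \<open>- \<alpha> + \<beta>\<close> and constant
      term \<open>\<alpha>\<close> takes the chromatic weights 0 and 1 to \<open>\<alpha>\<close>
      and \<open>\<beta>\<close>.\<close>
    have "\<alpha> ^ e_num G * (\<Sum>A\<in>spanning_subgraphs G.
        ((- \<alpha> + \<beta>) / \<alpha>) ^ e_num A * of_nat (chromatic A n)) = potts G n \<alpha> \<beta>"
      using conv[of \<alpha> "- \<alpha> + \<beta>" 0 1] 1 by (simp add: chrom)
    then show ?case using tutte[OF fin] 1 by simp
  next
    case 2
    let ?N = "of_nat n :: complex"
    have "?N - 1 \<noteq> 0 \<or> e_num G = 0"
    proof -
      have "(1 - ?N) ^ e_num G \<noteq> 0" using 2 G by blast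
      then show ?thesis by (cases "e_num G = 0") auto
    qed
    \<comment> \<open>Slope \<open>- n\<close> and constant term \<open>n - 1\<close> take the
      chromatic weights 0 and 1 to the flow weights \<open>n - 1\<close> and
      \<open>- 1\<close>.\<close>
    note c = conv[OF this, of "- ?N" 0 1]
    have "?N powi (int (e_num A) - int (v_num G)) / (1 - ?N) ^ e_num A * of_nat (chromatic A n)
        = 1 / ?N ^ v_num G * ((- ?N / (?N - 1)) ^ e_num A * potts A n 0 1)"
      if "A \<in> spanning_subgraphs G" for A
    proof -
      have "- ?N / (?N - 1) = ?N / (1 - ?N)" by (metis minus_diff_eq minus_divide_divide minus_minus)
      then show ?thesis unfolding powi chrom[OF that] by (simp add: power_divide)
    qed
    then have "(?N - 1) ^ e_num G * (\<Sum>A\<in>spanning_subgraphs G.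
        ?N powi (int (e_num A) - int (v_num G)) / (1 - ?N) ^ e_num A * of_nat (chromatic A n))
      = 1 / ?N ^ v_num G * potts G n (?N - 1) (- 1)"
      using c by (simp add: sum_distrib_left[symmetric] sum_divide_distrib[symmetric])
    then show ?case using flow[OF G] by simp
  next
    case 3
    let ?N = "of_nat n :: complex" and ?p = "(\<beta> - \<alpha>) / of_nat n"
      and ?q = "(\<alpha> - (1 - of_nat n) * \<beta>) / of_nat n"
    \<comment> \<open>The sign is absorbed into the slope, which becomes \<open>- ?p\<close>; the
      flow weights then go to \<open>\<alpha>\<close> and \<open>\<beta>\<close>.\<close>
    have sum: "(\<Sum>A\<in>spanning_subgraphs G. (?p / ?q) ^ e_num A * (- 1) ^ e_num A * of_nat (flow A n))
        = (\<Sum>A\<in>spanning_subgraphs G. (- ?p / ?q) ^ e_num A * potts A n (?N - 1) (- 1)) / ?N ^ v_num G"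
      unfolding sum_divide_distrib
    proof (intro sum.cong refl)
      fix A assume A: "A \<in> spanning_subgraphs G"
      have "(?p / ?q) ^ e_num A * (- 1) ^ e_num A = (- ?p / ?q) ^ e_num A"
        by (simp flip: power_mult_distrib)
      then show "(?p / ?q) ^ e_num A * (- 1) ^ e_num A * of_nat (flow A n)
          = (- ?p / ?q) ^ e_num A * potts A n (?N - 1) (- 1) / ?N ^ v_num G"
        by (simp only: flow[OF A] times_divide_eq_right)
    qed
    have "?q ^ e_num G * (\<Sum>A\<in>spanning_subgraphs G.
          (?p / ?q) ^ e_num A * (- 1) ^ e_num A * of_nat (flow A n))
        = potts G n (- ?p * (?N - 1) + ?q) (- ?p * (- 1) + ?q) / ?N ^ v_num G"
      unfolding sum times_divide_eq_right by (subst conv) (use 3 in simp_all)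
    also have "- ?p * (?N - 1) + ?q = \<alpha>" using n by (simp add: field_simps)
    also have "- ?p * (- 1) + ?q = \<beta>" using n by (simp add: field_simps)
    finally show ?case using tutte'[OF fin] 3 by simp
  next
    case 4
    let ?N = "of_nat n :: complex" and ?p = "of_nat n / (\<beta> - \<alpha>)"
      and ?q = "(\<alpha> - (1 - of_nat n) * \<beta>) / (\<alpha> - \<beta>)"
    have p: "?p = - (?N / (\<alpha> - \<beta>))"
      by (metis minus_diff_eq minus_divide_right)
    \<comment> \<open>The images of \<open>\<alpha>\<close> and \<open>\<beta>\<close> are the
      negated flow weights, whence the sign on the left of the formula. Naming the denominator
      \<open>d\<close> lets it be cleared as an atom before \<open>\<alpha> - \<beta>\<close> is
      substituted.\<close>
    have quot: "- (?N / d) * \<alpha> + (\<alpha> - (1 - ?N) * \<beta>) / d = - 1 * (?N - 1)"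
      "- (?N / d) * \<beta> + (\<alpha> - (1 - ?N) * \<beta>) / d = - 1 * (- 1)"
      if "d = \<alpha> - \<beta>" "d \<noteq> 0" for d
      using that(2) by (simp_all add: divide_simps) (simp_all add: that(1) algebra_simps)
    have sum: "(\<Sum>A\<in>spanning_subgraphs G.
          (?p / ?q) ^ e_num A * of_nat n powi (int (k_num A) - int (v_num G))
          * \<beta> powi c_num A * (\<alpha> - \<beta>) powi r_num A * tutte A ?x ?y)
        = (\<Sum>A\<in>spanning_subgraphs G. (?p / ?q) ^ e_num A * potts A n \<alpha> \<beta>) / ?N ^ v_num G"
      unfolding sum_divide_distrib
    proof (intro sum.cong refl)
      fix A assume "A \<in> spanning_subgraphs G"
      from tutte'[OF finite_multigraph_spanning_subgraph[OF fin this] 4(1,2), symmetric]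
      show "(?p / ?q) ^ e_num A * of_nat n powi (int (k_num A) - int (v_num G))
          * \<beta> powi c_num A * (\<alpha> - \<beta>) powi r_num A * tutte A ?x ?y
        = (?p / ?q) ^ e_num A * potts A n \<alpha> \<beta> / ?N ^ v_num G"
        by (simp only: mult.assoc times_divide_eq_right[symmetric])
    qed
    have "?q ^ e_num G * (\<Sum>A\<in>spanning_subgraphs G.
          (?p / ?q) ^ e_num A * of_nat n powi (int (k_num A) - int (v_num G))
          * \<beta> powi c_num A * (\<alpha> - \<beta>) powi r_num A * tutte A ?x ?y)
        = potts G n (?p * \<alpha> + ?q) (?p * \<beta> + ?q) / ?N ^ v_num G"
      unfolding sum times_divide_eq_right by (subst conv) (use 4 in simp_all)
    also have "?p * \<alpha> + ?q = - 1 * (?N - 1)"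
      unfolding p by (rule quot) (use 4 in simp_all)
    also have "?p * \<beta> + ?q = - 1 * (- 1)"
      unfolding p by (rule quot) (use 4 in simp_all)
    also have "potts G n (- 1 * (?N - 1)) (- 1 * (- 1)) = (- 1) ^ e_num G * potts G n (?N - 1) (- 1)"
      by (rule potts_scale)
    finally show ?case by (simp only: flow[OF G] times_divide_eq_right)
  qed
qed

end
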